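(* For any sets of formulas $\Sigma,\Gamma\subseteq\mathit{Fm}_I$ and any formula $\varphi\in\mathit{Fm}_I$, $$\Sigma;\Gamma\vdash\varphi\iff\Sigma;\Gamma\Vdash\varphi .$$
   Context: Fix a finite non-empty set $I$. **Formulas.** $\mathit{Fm}_I$ is the set of formulas built from countably many propositional variables $p_0,p_1,\dots$ and the constant $\bot$ using $\to$, unary connectives $\Box_i$ ($i\in I$) and a unary connective $\mathsf{C}$. Abbreviations: $\neg\varphi:=\varphi\to\bot$, $\top:=\neg\bot$, $\varphi\wedge\psi:=\neg(\varphi\to\neg\psi)$, $\varphi\vee\psi:=\neg\varphi\to\psi$, $\mathsf{E}\varphi:=\bigwedge_{i\in I}\Box_i\varphi$. An empty conjunction is $\top$. **Axioms of $\mathsf{S4}^C_I$** (schemas): (i) classical propositional tautologies (in this language); (ii) $\Box_i(\varphi\to\psi)\to(\Box_i\varphi\to\Box_i\psi)$; (iii) $\Box_i\varphi\to\Box_i\Box_i\varphi$; (iv) $\Box_i\varphi\to\varphi$; (v) $\mathsf{C}(\varphi\to\psi)\to(\mathsf{C}\varphi\to\mathsf{C}\psi)$; (vi) $\mathsf{C}\varphi\to\mathsf{E}\varphi\wedge\mathsf{E}\mathsf{C}\varphi$; (vii) $\mathsf{E}\varphi\wedge\mathsf{C}(\varphi\to\mathsf{E}\varphi)\to\mathsf{C}\varphi$ (for all $i\in I$). **Derivability.** An $\omega$-derivation is a well-founded tree whose nodes are marked by formulas and which is constructed according to the rules ($\mathsf{mp}$) from $\varphi$ and $\varphi\to\psi$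 infer $\psi$; ($\mathsf{nec}$) from $\varphi$ infer $\mathsf{C}\varphi$; ($\omega$) from the infinitely many premises $\varphi_j\to\mathsf{E}\psi\wedge\mathsf{E}\varphi_{j+1}$ ($j\in\mathbb{N}$) infer $\varphi_0\to\mathsf{C}\psi$. An assumption leaf is a leaf not marked by an axiom. $\Sigma\vdash_g\varphi$ means there is an $\omega$-derivation with root marked by $\varphi$ in which all assumption leaves are marked by elements of $\Sigma$. $\Sigma;\Gamma\vdash\varphi$ means there is a finite $\Gamma_0\subseteq\Gamma$ with $\Sigma\vdash_g\bigwedge\Gamma_0\to\varphi$. **Algebras.** An interior algebra is a Boolean algebra with a unary operation $\Box$ such that $\Box1=1$, $\Box(x\wedge y)=\Box x\wedge\Box y$, $\Box x=\Box\Box x$, $\Box x\le x$. An $\mathsf{S4}^C_I$-algebra is a Boolean algebra $A$ with unary operations $\Box_i$ ($i\in I$) and $\mathsf{C}$ such that each $\Box_i$ and $\mathsf{C}$ make $A$ an interior algebra, and $\mathsf{C}a\le\mathsf{E}a\wedge\mathsf{E}\mathsf{C}a$ and $\mathsf{E}a\wedge\mathsf{C}(a\to\mathsf{E}a)\le\mathsf{C}a$ for all $a\in A$, where $\mathsf{E}a:=\bigwedge_{i\in I}\Box_i a$. It is standard if, for every element $d$ and every sequence $(a_j)_{j\in\mathbb{N}}$ with $a_j\le\mathsf{E}d\wedge\mathsf{E}a_{j+1}$ for all $j$, we have $a_0\le\mathsf{C}d$. A valuation in an $\mathsf{S4}^C_I$-algebra with carrier $A$ is a map $v:\mathit{Fm}_I\to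 A$ with $v(\bot)=0$, $v(\varphi\to\psi)=v(\varphi)\to v(\psi)$, $v(\Box_i\varphi)=\Box_iv(\varphi)$, $v(\mathsf{C}\varphi)=\mathsf{C}v(\varphi)$. $\langle S\rangle$ denotes the filter generated by $S\subseteq A$. **Algebraic consequence.** $\Sigma;\Gamma\Vdash\varphi$ means: for every standard $\mathsf{S4}^C_I$-algebra and every valuation $v$ in it, if $v(\xi)=1$ for all $\xi\in\Sigma$, then $v(\varphi)\in\langle\{v(\psi)\mid\psi\in\Gamma\}\rangle$. *)

theory Defs
  imports "HOL-Algebra.Lattice"
begin

section \<open>Formulas\<close>

text \<open>The finite non-empty index set is the universe of the type \<open>'i::finite\<close>.\<close>

datatype 'i fm =
    Var nat
  | Bot
  | Imp "'i fm" "'i fm"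
  | Box 'i "'i fm"
  | CK "'i fm"

definition Neg :: "'i fm \<Rightarrow> 'i fm"
  where "Neg \<phi> = Imp \<phi> Bot"

definition Top :: "'i fm"
  where "Top = Neg Bot"

definition And :: "'i fm \<Rightarrow> 'i fm \<Rightarrow> 'i fm"
  where "And \<phi> \<psi> = Neg (Imp \<phi> (Neg \<psi>))"

fun Conj_list :: "'i fm list \<Rightarrow> 'i fm" where
  "Conj_list [] = Top"
| "Conj_list [\<phi>] = \<phi>"
| "Conj_list (\<phi> # \<psi> # \<phi>s) = And \<phi> (Conj_list (\<psi> # \<phi>s))"

text \<open>
  The conjunction of a finite set is bracketed to the right, along an arbitrary but fixed
  enumeration of the set without repetitions. It is unspecified on infinite sets.
\<close>

definition Conj :: "'i fm set \<Rightarrow> 'i fm"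
  where "Conj \<Phi> = Conj_list (SOME \<phi>s. distinct \<phi>s \<and> set \<phi>s = \<Phi>)"

definition EK :: "'i::finite fm \<Rightarrow> 'i fm"
  where "EK \<phi> = Conj (range (\<lambda>i. Box i \<phi>))"


section \<open>Derivations\<close>

text \<open>
  Tautologies in the modal language: the truth assignment \<open>e\<close> is arbitrary on variables and on
  formulas whose outermost connective is modal.
\<close>

definition tautology :: "'i fm \<Rightarrow> bool"
  where "tautology \<phi> \<longleftrightarrow>
    (\<forall>e :: 'i fm \<Rightarrow> bool. \<not> e Bot \<and> (\<forall>\<chi> \<psi>. e (Imp \<chi> \<psi>) \<longleftrightarrow> (e \<chi> \<longrightarrow> e \<psi>)) \<longrightarrow> e \<phi>)"

inductive s4c_axiom :: "'i::finite fm \<Rightarrow> bool" where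
  taut: "tautology \<phi> \<Longrightarrow> s4c_axiom \<phi>"
| box_K: "s4c_axiom (Imp (Box i (Imp \<phi> \<psi>)) (Imp (Box i \<phi>) (Box i \<psi>)))"
| box_4: "s4c_axiom (Imp (Box i \<phi>) (Box i (Box i \<phi>)))"
| box_T: "s4c_axiom (Imp (Box i \<phi>) \<phi>)"
| C_K: "s4c_axiom (Imp (CK (Imp \<phi> \<psi>)) (Imp (CK \<phi>) (CK \<psi>)))"
| C_unfold: "s4c_axiom (Imp (CK \<phi>) (And (EK \<phi>) (EK (CK \<phi>))))"
| C_ind: "s4c_axiom (Imp (And (EK \<phi>) (CK (Imp \<phi> (EK \<phi>)))) (CK \<phi>))"

text \<open>
  Trees of this datatype are well-founded but need not respect the inference rules; every node
  carries its own formula, and \<open>is_omega_derivation\<close> says that the rules are respected.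
\<close>

datatype 'i deriv_tree =
    Leaf (mark: "'i fm")
  | MP (mark: "'i fm") "'i deriv_tree" "'i deriv_tree"
  | Nec (mark: "'i fm") "'i deriv_tree"
  | Omega (mark: "'i fm") "nat \<Rightarrow> 'i deriv_tree"

primrec is_omega_derivation :: "'i::finite deriv_tree \<Rightarrow> bool" where
  "is_omega_derivation (Leaf \<phi>) \<longleftrightarrow> True"
| "is_omega_derivation (MP \<phi> t u) \<longleftrightarrow>
     is_omega_derivation t \<and> is_omega_derivation u \<and> mark u = Imp (mark t) \<phi>"
| "is_omega_derivation (Nec \<phi> t) \<longleftrightarrow> is_omega_derivation t \<and> \<phi> = CK (mark t)"
| "is_omega_derivation (Omega \<phi> t) \<longleftrightarrow>
     (\<forall>j. is_omega_derivation (t j)) \<and>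
     (\<exists>\<chi> \<psi>. (\<forall>j. mark (t j) = Imp (\<chi> j) (And (EK \<psi>) (EK (\<chi> (Suc j))))) \<and>
            \<phi> = Imp (\<chi> 0) (CK \<psi>))"

primrec leaf_marks :: "'i deriv_tree \<Rightarrow> 'i fm set" where
  "leaf_marks (Leaf \<phi>) = {\<phi>}"
| "leaf_marks (MP \<phi> t u) = leaf_marks t \<union> leaf_marks u"
| "leaf_marks (Nec \<phi> t) = leaf_marks t"
| "leaf_marks (Omega \<phi> t) = (\<Union>j. leaf_marks (t j))"

definition assumptions :: "'i::finite deriv_tree \<Rightarrow> 'i fm set"
  where "assumptions t = {\<phi> \<in> leaf_marks t. \<not> s4c_axiom \<phi>}"

definition derivable_global :: "'i::finite fm set \<Rightarrow> 'i fm \<Rightarrow> bool"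
  where "derivable_global \<Sigma> \<phi> \<longleftrightarrow>
    (\<exists>t. is_omega_derivation t \<and> mark t = \<phi> \<and> assumptions t \<subseteq> \<Sigma>)"

definition derivable :: "'i::finite fm set \<Rightarrow> 'i fm set \<Rightarrow> 'i fm \<Rightarrow> bool"
  where "derivable \<Sigma> \<Gamma> \<phi> \<longleftrightarrow>
    (\<exists>\<Gamma>\<^sub>0. finite \<Gamma>\<^sub>0 \<and> \<Gamma>\<^sub>0 \<subseteq> \<Gamma> \<and> derivable_global \<Sigma> (Imp (Conj \<Gamma>\<^sub>0) \<phi>))"


section \<open>Algebras\<close>

text \<open>Boolean algebras as complemented distributive lattices; the one-element algebra is included.\<close>

locale boolean_lattice = bounded_lattice +
  assumes distrib:
    "\<lbrakk>x \<in> carrier L; y \<in> carrier L; z \<in> carrier L\<rbrakk> \<Longrightarrow> x \<sqinter> (y \<squnion> z) = (x \<sqinter> y) \<squnion> (x \<sqinter> z)"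
  and complemented:
    "x \<in> carrier L \<Longrightarrow> \<exists>y \<in> carrier L. x \<sqinter> y = \<bottom> \<and> x \<squnion> y = \<top>"

definition complement :: "('a, 'c) gorder_scheme \<Rightarrow> 'a \<Rightarrow> 'a"
  where "complement L x =
    (THE y. y \<in> carrier L \<and> x \<sqinter>\<^bsub>L\<^esub> y = \<bottom>\<^bsub>L\<^esub> \<and> x \<squnion>\<^bsub>L\<^esub> y = \<top>\<^bsub>L\<^esub>)"

definition implication :: "('a, 'c) gorder_scheme \<Rightarrow> 'a \<Rightarrow> 'a \<Rightarrow> 'a"
  where "implication L x y = complement L x \<squnion>\<^bsub>L\<^esub> y"

locale interior_algebra = boolean_lattice L
  for L :: "('a, 'c) gorder_scheme" (structure) and I :: "'a \<Rightarrow> 'a" +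
  assumes closed: "x \<in> carrier L \<Longrightarrow> I x \<in> carrier L"
  and top: "I \<top> = \<top>"
  and meet: "\<lbrakk>x \<in> carrier L; y \<in> carrier L\<rbrakk> \<Longrightarrow> I (x \<sqinter> y) = I x \<sqinter> I y"
  and idem: "x \<in> carrier L \<Longrightarrow> I x = I (I x)"
  and deflationary: "x \<in> carrier L \<Longrightarrow> I x \<sqsubseteq> x"

record ('a, 'i) modal_lattice = "'a gorder" +
  box :: "'i \<Rightarrow> 'a \<Rightarrow> 'a"
  ck :: "'a \<Rightarrow> 'a"

definition ek :: "('a, 'i::finite) modal_lattice \<Rightarrow> 'a \<Rightarrow> 'a"
  where "ek L a = \<Sqinter>\<^bsub>L\<^esub> (range (\<lambda>i. box L i a))"

locale s4c_algebra = boolean_lattice L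
  for L :: "('a, 'i::finite) modal_lattice" (structure) +
  assumes box_interior: "interior_algebra L (box L i)"
  and ck_interior: "interior_algebra L (ck L)"
  and ck_unfold: "a \<in> carrier L \<Longrightarrow> ck L a \<sqsubseteq> ek L a \<sqinter> ek L (ck L a)"
  and ck_ind: "a \<in> carrier L \<Longrightarrow> ek L a \<sqinter> ck L (implication L a (ek L a)) \<sqsubseteq> ck L a"

locale standard_s4c_algebra = s4c_algebra +
  assumes standard:
    "\<lbrakk>d \<in> carrier L; \<And>j :: nat. a j \<in> carrier L; \<And>j. a j \<sqsubseteq> ek L d \<sqinter> ek L (a (Suc j))\<rbrakk>
      \<Longrightarrow> a 0 \<sqsubseteq> ck L d"

definition valuation :: "('a, 'i::finite) modal_lattice \<Rightarrow> ('i fm \<Rightarrow> 'a) \<Rightarrow> bool"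
  where "valuation L v \<longleftrightarrow>
    (\<forall>\<phi>. v \<phi> \<in> carrier L) \<and>
    v Bot = \<bottom>\<^bsub>L\<^esub> \<and>
    (\<forall>\<phi> \<psi>. v (Imp \<phi> \<psi>) = implication L (v \<phi>) (v \<psi>)) \<and>
    (\<forall>i \<phi>. v (Box i \<phi>) = box L i (v \<phi>)) \<and>
    (\<forall>\<phi>. v (CK \<phi>) = ck L (v \<phi>))"

text \<open>Filters are not required to be proper.\<close>

definition lattice_filter :: "('a, 'c) gorder_scheme \<Rightarrow> 'a set \<Rightarrow> bool"
  where "lattice_filter L F \<longleftrightarrow>
    F \<subseteq> carrier L \<and>
    \<top>\<^bsub>L\<^esub> \<in> F \<and>
    (\<forall>x \<in> F. \<forall>y \<in> F. x \<sqinter>\<^bsub>L\<^esub> y \<in> F) \<and>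
    (\<forall>x \<in> F. \<forall>y \<in> carrier L. x \<sqsubseteq>\<^bsub>L\<^esub> y \<longrightarrow> y \<in> F)"

definition generated_filter :: "('a, 'c) gorder_scheme \<Rightarrow> 'a set \<Rightarrow> 'a set"
  where "generated_filter L S = \<Inter> {F. lattice_filter L F \<and> S \<subseteq> F}"

text \<open>
  HOL cannot quantify over types inside a formula, so the consequence relation carries a universe
  type \<open>'u\<close> and ranges over all algebras whose carrier is any subset of \<open>'u\<close>, that is, up to
  isomorphism, over all algebras that are at most as large as \<open>'u\<close>. Consequence over the class of
  all algebras is consequence for every \<open>'u\<close>.
\<close>

definition alg_consequence ::
    "'u itself \<Rightarrow> 'i::finite fm set \<Rightarrow> 'i fm set \<Rightarrow> 'i fm \<Rightarrow> bool"
  where "alg_consequence U \<Sigma> \<Gamma> \<phi> \<longleftrightarrow>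
    (\<forall>(L :: ('u, 'i) modal_lattice) v.
       standard_s4c_algebra L \<and> valuation L v \<and> (\<forall>\<xi> \<in> \<Sigma>. v \<xi> = \<top>\<^bsub>L\<^esub>) \<longrightarrow>
       v \<phi> \<in> generated_filter L (v ` \<Gamma>))"

end

theory Submission
  imports Defs "HOL-Library.Countable"
begin

text \<open>
  Both directions are the classical argument for algebraic completeness; what the infinitary calculus
  adds is that the rule \<open>\<omega>\<close> and the standardness condition on algebras say the same thing.

  For soundness, every formula that is globally derivable from \<open>\<Sigma>\<close> takes the value \<open>\<top>\<close> whenever the
  members of \<open>\<Sigma>\<close> do (\<open>omega_derivation_valued_top\<close>). This goes by induction on the well-founded
  derivation tree: standardness is exactly what a node of the rule \<open>\<omega>\<close> requires. The modal
  axioms follow at once from the laws of the algebras. Evaluating a tautology in an abstract Boolean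
  lattice is reduced to truth tables by the prime filter theorem (\<open>prime_filter_avoiding\<close>):
  an element other than \<open>\<top>\<close> is missed by some prime filter, and belonging to that filter is a truth
  assignment. A derivation of \<open>\<And>\<Gamma>\<^sub>0 \<longrightarrow> \<phi>\<close> then puts the value of \<open>\<phi>\<close> above a finite meet of values of
  \<open>\<Gamma>\<close>, hence into the filter that they generate.

  For completeness, a single algebra suffices for a given \<open>\<Sigma>\<close>: the Lindenbaum algebra of
  formulas modulo equivalence provable from \<open>\<Sigma>\<close>. It is standard by the rule \<open>\<omega>\<close>
  (\<open>standard_s4c_algebra_alg\<close>), the quotient map is a valuation that sends \<open>\<Sigma>\<close> to \<open>\<top>\<close>, and the classes
  of the formulas derivable from \<open>\<Gamma>\<close> form a filter, so a consequence of \<open>\<Gamma>\<close> is derivable from \<open>\<Gamma>\<close>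
  (\<open>derivable_if_in_generated_filter\<close>). There are only countably many formulas, hence countably many
  classes, and these can be named by elements of any infinite type. This is why every infinite
  universe yields the same consequence relation.
\<close>

section \<open>Boolean lattices and prime filters\<close>

context boolean_lattice
begin

lemma disjoint_le_covering:
  assumes "x \<in> carrier L" "y \<in> carrier L" "z \<in> carrier L"
    and "x \<sqinter> y = \<bottom>" "x \<squnion> z = \<top>"
  shows "y \<sqsubseteq> z"
proof -
  have "y = y \<sqinter> (x \<squnion> z)"
    using assms by (metis le_iff_join top_closed top_higher)
  also have "\<dots> = (y \<sqinter> x) \<squnion> (y \<sqinter> z)"
    using assms distrib by blast
  also have "\<dots> \<sqsubseteq> z"
    using assms by (metis bottom_closed bottom_lower join_le meet_closed meet_comm meet_right)
  finally show ?thesis .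
qed

lemma complement_eqI:
  assumes "x \<in> carrier L" "y \<in> carrier L" "x \<sqinter> y = \<bottom>" "x \<squnion> y = \<top>"
  shows "complement L x = y"
  unfolding complement_def
proof (rule the_equality)
  show "y \<in> carrier L \<and> x \<sqinter> y = \<bottom> \<and> x \<squnion> y = \<top>"
    using assms by blast
  show "z = y" if "z \<in> carrier L \<and> x \<sqinter> z = \<bottom> \<and> x \<squnion> z = \<top>" for z
    using that assms disjoint_le_covering[of x y z] disjoint_le_covering[of x z y]
    by (auto intro: le_antisym)
qed

lemma complement_spec:
  assumes "x \<in> carrier L"
  shows "complement L x \<in> carrier L \<and> x \<sqinter> complement L x = \<bottom> \<and> x \<squnion> complement L x = \<top>"
proof -
  obtain y where y: "y \<in> carrier L" "x \<sqinter> y = \<bottom>" "x \<squnion> y = \<top>"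
    using complemented[OF assms] by blast
  then have "complement L x = y"
    by (intro complement_eqI assms)
  with y show ?thesis by simp
qed

lemmas complement_closed [simp] = complement_spec[THEN conjunct1]
  and meet_complement = complement_spec[THEN conjunct2, THEN conjunct1]
  and join_complement = complement_spec[THEN conjunct2, THEN conjunct2]

lemma implication_closed [simp]:
  "x \<in> carrier L \<Longrightarrow> y \<in> carrier L \<Longrightarrow> implication L x y \<in> carrier L"
  by (simp add: implication_def)

lemma le_by_cases:
  assumes [simp]: "x \<in> carrier L" "y \<in> carrier L" "z \<in> carrier L"
    and "z \<sqinter> x \<sqsubseteq> y" "z \<sqinter> complement L x \<sqsubseteq> y"
  shows "z \<sqsubseteq> y"
proof -
  have "z = z \<sqinter> (x \<squnion> complement L x)"
    by (metis assms(1,3) join_complement le_iff_join top_closed top_higher)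
  also have "\<dots> = (z \<sqinter> x) \<squnion> (z \<sqinter> complement L x)"
    using distrib by simp
  also have "\<dots> \<sqsubseteq> y"
    using assms by (intro join_le) auto
  finally show ?thesis .
qed

lemma meet_implication_le:
  assumes [simp]: "x \<in> carrier L" "y \<in> carrier L"
  shows "x \<sqinter> implication L x y \<sqsubseteq> y"
proof -
  have "x \<sqinter> implication L x y = (x \<sqinter> complement L x) \<squnion> (x \<sqinter> y)"
    unfolding implication_def using distrib by simp
  also have "\<dots> \<sqsubseteq> y"
    by (intro join_le) (auto simp: meet_complement meet_right bottom_lower)
  finally show ?thesis .
qed

lemma le_implication_iff:
  assumes [simp]: "x \<in> carrier L" "y \<in> carrier L" "z \<in> carrier L"
  shows "z \<sqsubseteq> implication L x y \<longleftrightarrow> z \<sqinter> x \<sqsubseteq> y"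
proof
  assume z: "z \<sqsubseteq> implication L x y"
  have "z \<sqinter> x \<sqsubseteq> x \<sqinter> implication L x y"
    by (intro meet_le meet_right le_trans[OF meet_left z]) auto
  then show "z \<sqinter> x \<sqsubseteq> y"
    by (rule le_trans[OF _ meet_implication_le]) auto
next
  assume z: "z \<sqinter> x \<sqsubseteq> y"
  show "z \<sqsubseteq> implication L x y"
  proof (rule le_by_cases[of x])
    show "z \<sqinter> x \<sqsubseteq> implication L x y"
      unfolding implication_def by (rule le_trans[OF z join_right]) auto
    show "z \<sqinter> complement L x \<sqsubseteq> implication L x y"
      unfolding implication_def by (rule le_trans[OF meet_right join_left]) auto
  qed auto
qed

lemma implication_eq_top_iff:
  assumes [simp]: "x \<in> carrier L" "y \<in> carrier L"
  shows "implication L x y = \<top> \<longleftrightarrow> x \<sqsubseteq> y"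
proof -
  have "\<top> \<sqinter> x = x"
    by (metis assms(1) le_iff_join meet_comm top_closed top_higher)
  then show ?thesis
    using le_implication_iff[of x y \<top>]
    by (metis assms implication_closed le_antisym le_refl top_closed top_higher)
qed

text \<open>This is the filter generated by \<open>F\<close> and \<open>x\<close>, the step by which a filter is enlarged.\<close>

lemma lattice_filter_principal_extension:
  assumes F: "lattice_filter L F" and x: "x \<in> carrier L"
  shows "lattice_filter L {y \<in> carrier L. \<exists>f \<in> F. f \<sqinter> x \<sqsubseteq> y}" (is "lattice_filter L ?G")
proof -
  have sub: "f \<in> carrier L" if "f \<in> F" for f
    using F that by (auto simp: lattice_filter_def)
  have "\<top> \<in> ?G"
    using F x by (auto simp: lattice_filter_def intro!: bexI[of _ \<top>] top_higher)
  moreover have "y \<sqinter> z \<in> ?G" if "y \<in> ?G" "z \<in> ?G" for y z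
  proof -
    from that obtain f g where fg: "f \<in> F" "g \<in> F" "f \<sqinter> x \<sqsubseteq> y" "g \<sqinter> x \<sqsubseteq> z"
      and [simp]: "y \<in> carrier L" "z \<in> carrier L" by auto
    note [simp] = sub[OF fg(1)] sub[OF fg(2)] x
    have "(f \<sqinter> g) \<sqinter> x \<sqsubseteq> f \<sqinter> x" "(f \<sqinter> g) \<sqinter> x \<sqsubseteq> g \<sqinter> x"
      by (intro meet_le meet_right le_trans[OF meet_left meet_left]
            le_trans[OF meet_left meet_right]; simp)+
    then have "(f \<sqinter> g) \<sqinter> x \<sqsubseteq> y \<sqinter> z"
      by (intro meet_le) (simp_all add: le_trans[OF _ fg(3)] le_trans[OF _ fg(4)])
    moreover have "f \<sqinter> g \<in> F"
      using F fg by (auto simp: lattice_filter_def)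
    ultimately show ?thesis by auto
  qed
  moreover have "z \<in> ?G" if "y \<in> ?G" "z \<in> carrier L" "y \<sqsubseteq> z" for y z
  proof -
    from that obtain f where f: "f \<in> F" "f \<sqinter> x \<sqsubseteq> y" "y \<in> carrier L" by auto
    then have "f \<sqinter> x \<sqsubseteq> z"
      using that x sub by (meson le_trans meet_closed)
    then show ?thesis using f that by auto
  qed
  ultimately show ?thesis
    by (auto simp: lattice_filter_def)
qed

text \<open>
  Zorn's lemma yields a filter \<open>F\<close> that is maximal among those missing \<open>a\<close>. If \<open>F\<close> contained neither
  \<open>x\<close> nor its complement, adjoining either one would bring in \<open>a\<close>, so some \<open>f \<in> F\<close> would lie below
  \<open>a\<close> both on \<open>x\<close> and on the complement of \<open>x\<close>, that is, altogether.
\<close>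

lemma prime_filter_avoiding:
  assumes a: "a \<in> carrier L" "a \<noteq> \<top>"
  obtains F where "lattice_filter L F" "a \<notin> F"
    "\<And>x. x \<in> carrier L \<Longrightarrow> x \<in> F \<or> complement L x \<in> F"
proof -
  let ?A = "{F. lattice_filter L F \<and> a \<notin> F}"
  have "\<top> \<sqinter> \<top> = \<top>"
    by (metis le_iff_join le_refl top_closed)
  moreover have "y = \<top>" if "y \<in> carrier L" "\<top> \<sqsubseteq> y" for y
    using that by (metis le_antisym top_closed top_higher)
  ultimately have "lattice_filter L {\<top>}"
    unfolding lattice_filter_def by simp
  then have top: "{\<top>} \<in> ?A" using a by auto
  have chains: "\<exists>U \<in> ?A. \<forall>F \<in> C. F \<subseteq> U" if C: "subset.chain ?A C" for C
  proof (cases "C = {}")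
    case True
    then show ?thesis using top by auto
  next
    case False
    have mem: "lattice_filter L F" "a \<notin> F" if "F \<in> C" for F
      using C that by (auto simp: subset_chain_def)
    have "x \<sqinter> y \<in> \<Union>C" if "x \<in> \<Union>C" "y \<in> \<Union>C" for x y
    proof -
      obtain F G where FG: "F \<in> C" "G \<in> C" "x \<in> F" "y \<in> G" using \<open>x \<in> \<Union>C\<close> \<open>y \<in> \<Union>C\<close> by auto
      moreover from this have "F \<subseteq> G \<or> G \<subseteq> F"
        using C by (auto simp: subset_chain_def)
      ultimately obtain H where "H \<in> C" "x \<in> H" "y \<in> H"
        by (metis subsetD)
      then show ?thesis using mem(1) by (auto simp: lattice_filter_def)
    qed
    moreover have "\<top> \<in> \<Union>C"
      using False mem(1) by (auto simp: lattice_filter_def)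
    moreover have "\<Union>C \<subseteq> carrier L" "\<forall>x \<in> \<Union>C. \<forall>y \<in> carrier L. x \<sqsubseteq> y \<longrightarrow> y \<in> \<Union>C"
      using mem(1) unfolding lattice_filter_def by blast+
    ultimately have "lattice_filter L (\<Union>C)"
      by (auto simp: lattice_filter_def)
    then show ?thesis using mem(2) by (intro bexI[of _ "\<Union>C"]) auto
  qed
  obtain F where F: "lattice_filter L F" "a \<notin> F"
    and max: "\<And>G. lattice_filter L G \<Longrightarrow> a \<notin> G \<Longrightarrow> F \<subseteq> G \<Longrightarrow> G = F"
    using subset_Zorn[OF chains] by auto
  have sub: "f \<in> carrier L" if "f \<in> F" for f
    using F that by (auto simp: lattice_filter_def)
  have reach: "\<exists>f \<in> F. f \<sqinter> x \<sqsubseteq> a" if x: "x \<in> carrier L" "x \<notin> F" for x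
  proof (rule ccontr)
    assume no: "\<not> (\<exists>f \<in> F. f \<sqinter> x \<sqsubseteq> a)"
    let ?G = "{y \<in> carrier L. \<exists>f \<in> F. f \<sqinter> x \<sqsubseteq> y}"
    have "?G = F"
    proof (rule max)
      show "lattice_filter L ?G"
        using F(1) x(1) by (rule lattice_filter_principal_extension)
      show "F \<subseteq> ?G"
        using sub meet_left[OF sub x(1)] by blast
    qed (use no in blast)
    moreover have "\<top> \<in> F" "\<top> \<sqinter> x \<sqsubseteq> x"
      using F(1) meet_right[OF top_closed x(1)] by (simp_all add: lattice_filter_def)
    then have "x \<in> ?G"
      using x(1) by blast
    ultimately show False using x by blast
  qed
  have "x \<in> F \<or> complement L x \<in> F" if x: "x \<in> carrier L" for x
  proof (rule ccontr)
    assume "\<not> ?thesis"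
    then obtain f g where fg: "f \<in> F" "g \<in> F" "f \<sqinter> x \<sqsubseteq> a" "g \<sqinter> complement L x \<sqsubseteq> a"
      using reach x complement_closed by metis
    note [simp] = sub[OF fg(1)] sub[OF fg(2)] x a(1)
    have "(f \<sqinter> g) \<sqinter> x \<sqsubseteq> f \<sqinter> x" "(f \<sqinter> g) \<sqinter> complement L x \<sqsubseteq> g \<sqinter> complement L x"
      by (intro meet_le meet_right le_trans[OF meet_left meet_left]
            le_trans[OF meet_left meet_right]; simp)+
    then have "(f \<sqinter> g) \<sqinter> x \<sqsubseteq> a" "(f \<sqinter> g) \<sqinter> complement L x \<sqsubseteq> a"
      using fg(3,4) by (simp_all add: le_trans[OF _ fg(3)] le_trans[OF _ fg(4)])
    then have "f \<sqinter> g \<sqsubseteq> a"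
      by (rule le_by_cases[of x, rotated 3]) auto
    moreover have "f \<sqinter> g \<in> F"
      using F fg by (auto simp: lattice_filter_def)
    ultimately show False
      using F a by (auto simp: lattice_filter_def)
  qed
  with F show thesis by (rule that)
qed

end


section \<open>Propositional reasoning\<close>

text \<open>
  The bracketing and the order chosen by \<^const>\<open>Conj\<close> are arbitrary; this rule is the only access to
  them, and everything below depends only on the set of conjuncts.
\<close>

lemma Conj_enumeration:
  assumes "finite \<Phi>"
  obtains \<phi>s where "set \<phi>s = \<Phi>" "Conj \<Phi> = Conj_list \<phi>s"
proof -
  have "\<exists>\<phi>s. distinct \<phi>s \<and> set \<phi>s = \<Phi>"
    using finite_distinct_list[OF assms] by blast
  from someI_ex[OF this] show thesis
    by (intro that[of "SOME \<phi>s. distinct \<phi>s \<and> set \<phi>s = \<Phi>"]) (auto simp: Conj_def)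
qed

definition truth_assignment :: "('i fm \<Rightarrow> bool) \<Rightarrow> bool"
  where "truth_assignment e \<longleftrightarrow> \<not> e Bot \<and> (\<forall>\<chi> \<psi>. e (Imp \<chi> \<psi>) \<longleftrightarrow> (e \<chi> \<longrightarrow> e \<psi>))"

lemma tautology_iff: "tautology \<phi> \<longleftrightarrow> (\<forall>e. truth_assignment e \<longrightarrow> e \<phi>)"
  by (simp add: tautology_def truth_assignment_def)

lemma truth_assignment_simps:
  assumes "truth_assignment e"
  shows "e Bot \<longleftrightarrow> False" "e (Imp \<phi> \<psi>) \<longleftrightarrow> (e \<phi> \<longrightarrow> e \<psi>)" "e (Neg \<phi>) \<longleftrightarrow> \<not> e \<phi>"
    "e Top \<longleftrightarrow> True" "e (And \<phi> \<psi>) \<longleftrightarrow> e \<phi> \<and> e \<psi>"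
  using assms by (auto simp: truth_assignment_def Neg_def Top_def And_def)

lemma truth_assignment_Conj_list:
  "truth_assignment e \<Longrightarrow> e (Conj_list \<phi>s) \<longleftrightarrow> (\<forall>\<phi> \<in> set \<phi>s. e \<phi>)"
  by (induction \<phi>s rule: Conj_list.induct) (auto simp: truth_assignment_simps)

lemma truth_assignment_Conj:
  "truth_assignment e \<Longrightarrow> finite \<Phi> \<Longrightarrow> e (Conj \<Phi>) \<longleftrightarrow> (\<forall>\<phi> \<in> \<Phi>. e \<phi>)"
  by (metis Conj_enumeration truth_assignment_Conj_list)

lemma truth_assignment_EK: "truth_assignment e \<Longrightarrow> e (EK \<phi>) \<longleftrightarrow> (\<forall>i. e (Box i \<phi>))"
  by (simp add: EK_def truth_assignment_Conj)

text \<open>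
  With these rules the simplifier decides whether a schematic formula is a tautology, by turning it
  into the corresponding statement about truth values.
\<close>

lemmas tautology_simps =
  tautology_iff truth_assignment_simps truth_assignment_Conj truth_assignment_EK


section \<open>Soundness\<close>

context boolean_lattice
begin

text \<open>
  A value other than \<open>\<top>\<close> would be missed by a prime filter; since membership in a prime filter is a
  truth assignment, the formula would fail under it.
\<close>

lemma tautology_valued_top:
  assumes closed: "\<And>\<phi>. v \<phi> \<in> carrier L"
    and Bot: "v Bot = \<bottom>"
    and Imp: "\<And>\<phi> \<psi>. v (Imp \<phi> \<psi>) = implication L (v \<phi>) (v \<psi>)"
    and taut: "tautology \<phi>"
  shows "v \<phi> = \<top>"
proof (rule ccontr)
  assume "v \<phi> \<noteq> \<top>"
  with closed obtain F where F: "lattice_filter L F" "v \<phi> \<notin> F"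
    and prime: "\<And>x. x \<in> carrier L \<Longrightarrow> x \<in> F \<or> complement L x \<in> F"
    by (metis prime_filter_avoiding)
  have up: "y \<in> F" if "x \<in> F" "y \<in> carrier L" "x \<sqsubseteq> y" for x y
    using F that by (auto simp: lattice_filter_def)
  have "\<bottom> \<notin> F"
    using F closed up bottom_lower by blast
  moreover have "implication L x y \<in> F \<longleftrightarrow> (x \<in> F \<longrightarrow> y \<in> F)"
    if [simp]: "x \<in> carrier L" "y \<in> carrier L" for x y
  proof (intro iffI impI)
    assume "implication L x y \<in> F" "x \<in> F"
    then have "x \<sqinter> implication L x y \<in> F"
      using F by (auto simp: lattice_filter_def)
    then show "y \<in> F"
      by (rule up) (auto intro: meet_implication_le)
  next
    assume "x \<in> F \<longrightarrow> y \<in> F"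
    then have "complement L x \<in> F \<or> y \<in> F"
      using prime that by blast
    then show "implication L x y \<in> F"
      unfolding implication_def using up join_left join_right
      by (meson complement_closed join_closed that)
  qed
  ultimately have "truth_assignment (\<lambda>\<psi>. v \<psi> \<in> F)"
    by (simp add: truth_assignment_def closed Bot Imp)
  then show False
    using taut F(2) by (auto simp: tautology_iff)
qed

end

context s4c_algebra
begin

context
  fixes v
  assumes v: "valuation L v"
begin

lemma valuation_simps:
  "v \<phi> \<in> carrier L" "v Bot = \<bottom>" "v (Imp \<phi> \<psi>) = implication L (v \<phi>) (v \<psi>)"
  "v (Box i \<phi>) = box L i (v \<phi>)" "v (CK \<phi>) = ck L (v \<phi>)"
  using v by (auto simp: valuation_def)

lemma valuation_tautology: "tautology \<phi> \<Longrightarrow> v \<phi> = \<top>"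
  by (rule tautology_valued_top) (auto simp: valuation_simps)

lemma valuation_Imp_eq_top: "v (Imp \<phi> \<psi>) = \<top> \<longleftrightarrow> v \<phi> \<sqsubseteq> v \<psi>"
  by (simp add: valuation_simps implication_eq_top_iff)

lemma valuation_tautology_le: "tautology (Imp \<phi> \<psi>) \<Longrightarrow> v \<phi> \<sqsubseteq> v \<psi>"
  using valuation_tautology valuation_Imp_eq_top by blast

text \<open>
  Conjunction is an abbreviation in terms of implication and \<open>\<bottom>\<close>. Instead of computing with
  complements, both inequalities are read off from tautologies, the second one by residuation.
\<close>

lemma valuation_And: "v (And \<phi> \<psi>) = v \<phi> \<sqinter> v \<psi>"
proof (rule le_antisym)
  show "v (And \<phi> \<psi>) \<sqsubseteq> v \<phi> \<sqinter> v \<psi>"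
    by (intro meet_le valuation_tautology_le) (auto simp: tautology_simps valuation_simps)
  have "v \<phi> \<sqsubseteq> v (Imp \<psi> (And \<phi> \<psi>))"
    by (rule valuation_tautology_le) (auto simp: tautology_simps)
  then show "v \<phi> \<sqinter> v \<psi> \<sqsubseteq> v (And \<phi> \<psi>)"
    by (simp add: valuation_simps le_implication_iff)
qed (auto simp: valuation_simps)

lemma valuation_Conj_list_greatest: "greatest L (v (Conj_list \<phi>s)) (Lower L (v ` set \<phi>s))"
proof (rule greatest_LowerI)
  show "v (Conj_list \<phi>s) \<sqsubseteq> x" if "x \<in> v ` set \<phi>s" for x
    using that
    by (auto intro!: valuation_tautology_le simp: tautology_simps truth_assignment_Conj_list)
  show "y \<sqsubseteq> v (Conj_list \<phi>s)" if "y \<in> Lower L (v ` set \<phi>s)" for y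
    using that
  proof (induction \<phi>s rule: Conj_list.induct)
    case 1
    have "v Top = \<top>"
      by (rule valuation_tautology) (simp add: tautology_simps)
    with 1 show ?case by (simp add: Lower_def top_higher)
  next
    case (2 \<phi>)
    then show ?case by (auto simp: Lower_def valuation_simps)
  next
    case (3 \<phi> \<psi> \<phi>s)
    then show ?case by (auto simp: Lower_def valuation_simps valuation_And intro!: meet_le)
  qed
qed (auto simp: valuation_simps)

lemma valuation_EK: "v (EK \<phi>) = ek L (v \<phi>)"
proof -
  obtain \<phi>s where "set \<phi>s = range (\<lambda>i. Box i \<phi>)" "EK \<phi> = Conj_list \<phi>s"
    unfolding EK_def by (rule Conj_enumeration[of "range (\<lambda>i. Box i \<phi>)"]) auto
  moreover have "v ` range (\<lambda>i. Box i \<phi>) = range (\<lambda>i. box L i (v \<phi>))"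
    by (simp add: image_image valuation_simps)
  ultimately have "greatest L (v (EK \<phi>)) (Lower L (range (\<lambda>i. box L i (v \<phi>))))"
    using valuation_Conj_list_greatest by metis
  then show ?thesis
    unfolding ek_def inf_def by (metis greatest_unique someI_ex)
qed

lemma valuation_Conj_in_filter:
  assumes "finite \<Phi>" "lattice_filter L F" "v ` \<Phi> \<subseteq> F"
  shows "v (Conj \<Phi>) \<in> F"
proof -
  have "v Top = \<top>"
    by (rule valuation_tautology) (simp add: tautology_simps)
  then have "v (Conj_list \<phi>s) \<in> F" if "v ` set \<phi>s \<subseteq> F" for \<phi>s
    using that assms(2)
    by (induction \<phi>s rule: Conj_list.induct) (auto simp: valuation_And lattice_filter_def)
  then show ?thesis
    using assms by (metis Conj_enumeration)
qed

end

end

context interior_algebra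
begin

lemma interior_mono:
  assumes "x \<in> carrier L" "y \<in> carrier L" "x \<sqsubseteq> y"
  shows "I x \<sqsubseteq> I y"
  using assms meet[of x y] closed by (metis le_iff_join)

lemma interior_implication:
  assumes [simp]: "x \<in> carrier L" "y \<in> carrier L"
  shows "I (implication L x y) \<sqsubseteq> implication L (I x) (I y)"
proof -
  have "I (implication L x y) \<sqinter> I x = I (x \<sqinter> implication L x y)"
    by (simp add: meet meet_comm)
  also have "\<dots> \<sqsubseteq> I y"
    by (rule interior_mono) (auto intro: meet_implication_le)
  finally show ?thesis
    by (simp add: le_implication_iff closed)
qed

end

lemma (in s4c_algebra) axiom_valued_top:
  assumes v: "valuation L v" and "s4c_axiom \<phi>"
  shows "v \<phi> = \<top>"
  using assms(2)
proof cases
  case taut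
  then show ?thesis by (rule valuation_tautology[OF v])
next
  case (box_K i \<phi> \<psi>)
  interpret i: interior_algebra L "box L i" by (rule box_interior)
  show ?thesis unfolding box_K valuation_Imp_eq_top[OF v]
    by (simp add: valuation_simps[OF v] i.interior_implication)
next
  case (box_4 i \<phi>)
  interpret i: interior_algebra L "box L i" by (rule box_interior)
  have "v (Box i (Box i \<phi>)) = v (Box i \<phi>)"
    unfolding valuation_simps(4)[OF v] by (rule i.idem[symmetric]) (rule valuation_simps(1)[OF v])
  then show ?thesis unfolding box_4 valuation_Imp_eq_top[OF v]
    by (metis le_refl valuation_simps(1)[OF v])
next
  case (box_T i \<phi>)
  interpret i: interior_algebra L "box L i" by (rule box_interior)
  show ?thesis unfolding box_T valuation_Imp_eq_top[OF v]
    by (simp add: valuation_simps[OF v] i.deflationary)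
next
  case (C_K \<phi> \<psi>)
  interpret c: interior_algebra L "ck L" by (rule ck_interior)
  show ?thesis unfolding C_K valuation_Imp_eq_top[OF v]
    by (simp add: valuation_simps[OF v] c.interior_implication)
next
  case (C_unfold \<phi>)
  show ?thesis unfolding C_unfold valuation_Imp_eq_top[OF v]
    by (simp add: valuation_simps[OF v] valuation_And[OF v] valuation_EK[OF v] ck_unfold)
next
  case (C_ind \<phi>)
  show ?thesis unfolding C_ind valuation_Imp_eq_top[OF v]
    by (simp add: valuation_simps[OF v] valuation_And[OF v] valuation_EK[OF v] ck_ind)
qed

context standard_s4c_algebra
begin

text \<open>
  At a node of the rule \<open>\<omega>\<close> the values of the antecedents form a sequence as in the definition of
  standardness, because all of its infinitely many premises have value \<open>\<top>\<close>.
\<close>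

lemma omega_derivation_valued_top:
  assumes v: "valuation L v" and "is_omega_derivation t"
    and "\<And>\<xi>. \<xi> \<in> assumptions t \<Longrightarrow> v \<xi> = \<top>"
  shows "v (mark t) = \<top>"
  using assms(2,3)
proof (induction t)
  case (Leaf \<phi>)
  then show ?case using axiom_valued_top[OF v] by (auto simp: assumptions_def)
next
  case (MP \<phi> t u)
  then have "v (mark t) = \<top>" "v (Imp (mark t) \<phi>) = \<top>"
    by (auto simp: assumptions_def)
  then have "\<top> \<sqsubseteq> v \<phi>"
    by (simp add: valuation_Imp_eq_top[OF v])
  then show ?case
    by (simp add: le_antisym top_higher valuation_simps[OF v])
next
  case (Nec \<phi> t)
  interpret c: interior_algebra L "ck L" by (rule ck_interior)
  from Nec have "v (mark t) = \<top>" by (auto simp: assumptions_def)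
  with Nec show ?case by (simp add: valuation_simps[OF v] c.top)
next
  case (Omega \<phi> t)
  then obtain \<chi> \<psi> where \<phi>: "\<phi> = Imp (\<chi> 0) (CK \<psi>)"
    and t: "\<And>j. mark (t j) = Imp (\<chi> j) (And (EK \<psi>) (EK (\<chi> (Suc j))))" by auto
  have "v (mark (t j)) = \<top>" for j
    using Omega by (intro Omega.IH) (auto simp: assumptions_def)
  then have "v (\<chi> 0) \<sqsubseteq> ck L (v \<psi>)"
    by (intro standard[of "v \<psi>" "\<lambda>j. v (\<chi> j)"])
      (auto simp: t valuation_Imp_eq_top[OF v] valuation_simps(1)[OF v] valuation_And[OF v]
        valuation_EK[OF v])
  then show ?case by (simp add: \<phi> valuation_Imp_eq_top[OF v] valuation_simps(5)[OF v])
qed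

lemma derivable_in_generated_filter:
  assumes v: "valuation L v" and \<Sigma>: "\<forall>\<xi> \<in> \<Sigma>. v \<xi> = \<top>" and "derivable \<Sigma> \<Gamma> \<phi>"
  shows "v \<phi> \<in> generated_filter L (v ` \<Gamma>)"
  unfolding generated_filter_def
proof (rule InterI, clarify)
  fix F
  assume F: "lattice_filter L F" "v ` \<Gamma> \<subseteq> F"
  obtain \<Gamma>\<^sub>0 t where \<Gamma>0: "finite \<Gamma>\<^sub>0" "\<Gamma>\<^sub>0 \<subseteq> \<Gamma>"
    and t: "is_omega_derivation t" "mark t = Imp (Conj \<Gamma>\<^sub>0) \<phi>" "assumptions t \<subseteq> \<Sigma>"
    using assms(3) by (auto simp: derivable_def derivable_global_def)
  have "v (Conj \<Gamma>\<^sub>0) \<sqsubseteq> v \<phi>"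
    using omega_derivation_valued_top[OF v t(1)] t \<Sigma> valuation_Imp_eq_top[OF v] by auto
  moreover have "v (Conj \<Gamma>\<^sub>0) \<in> F"
    using valuation_Conj_in_filter[OF v] \<Gamma>0 F by blast
  ultimately show "v \<phi> \<in> F"
    using F(1) valuation_simps(1)[OF v] by (auto simp: lattice_filter_def)
qed

end


section \<open>Derivable formulas\<close>

lemma derivable_global_axiom: "s4c_axiom \<phi> \<Longrightarrow> derivable_global \<Sigma> \<phi>"
  unfolding derivable_global_def by (rule exI[of _ "Leaf \<phi>"]) (auto simp: assumptions_def)

lemma derivable_global_assumption: "\<phi> \<in> \<Sigma> \<Longrightarrow> derivable_global \<Sigma> \<phi>"
  unfolding derivable_global_def by (rule exI[of _ "Leaf \<phi>"]) (auto simp: assumptions_def)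

lemma derivable_global_mp:
  assumes "derivable_global \<Sigma> (Imp \<phi> \<psi>)" "derivable_global \<Sigma> \<phi>"
  shows "derivable_global \<Sigma> \<psi>"
proof -
  from assms obtain t u where "is_omega_derivation t" "mark t = \<phi>" "assumptions t \<subseteq> \<Sigma>"
    "is_omega_derivation u" "mark u = Imp \<phi> \<psi>" "assumptions u \<subseteq> \<Sigma>"
    by (auto simp: derivable_global_def)
  then show ?thesis
    unfolding derivable_global_def by (intro exI[of _ "MP \<psi> t u"]) (auto simp: assumptions_def)
qed

lemma derivable_global_nec:
  assumes "derivable_global \<Sigma> \<phi>"
  shows "derivable_global \<Sigma> (CK \<phi>)"
proof -
  from assms obtain t where "is_omega_derivation t" "mark t = \<phi>" "assumptions t \<subseteq> \<Sigma>"
    by (auto simp: derivable_global_def)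
  then show ?thesis
    unfolding derivable_global_def by (intro exI[of _ "Nec (CK \<phi>) t"]) (auto simp: assumptions_def)
qed

lemma derivable_global_omega:
  assumes "\<And>j. derivable_global \<Sigma> (Imp (\<chi> j) (And (EK \<psi>) (EK (\<chi> (Suc j)))))"
  shows "derivable_global \<Sigma> (Imp (\<chi> 0) (CK \<psi>))"
proof -
  from assms obtain t where "\<And>j. is_omega_derivation (t j)" "\<And>j. assumptions (t j) \<subseteq> \<Sigma>"
    "\<And>j. mark (t j) = Imp (\<chi> j) (And (EK \<psi>) (EK (\<chi> (Suc j))))"
    unfolding derivable_global_def by metis
  then show ?thesis
    unfolding derivable_global_def
    by (intro exI[of _ "Omega (Imp (\<chi> 0) (CK \<psi>)) t"]) (auto simp: assumptions_def)
qed

lemma derivable_global_tautology: "tautology \<phi> \<Longrightarrow> derivable_global \<Sigma> \<phi>"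
  by (intro derivable_global_axiom taut)

lemma derivable_global_consequence:
  assumes "derivable_global \<Sigma> \<phi>" "tautology (Imp \<phi> \<psi>)"
  shows "derivable_global \<Sigma> \<psi>"
  using assms derivable_global_tautology derivable_global_mp by blast

lemma derivable_global_consequence2:
  assumes "derivable_global \<Sigma> \<phi>" "derivable_global \<Sigma> \<psi>" "tautology (Imp \<phi> (Imp \<psi> \<chi>))"
  shows "derivable_global \<Sigma> \<chi>"
  using assms derivable_global_tautology derivable_global_mp by blast

lemma derivable_global_Imp_trans:
  assumes "derivable_global \<Sigma> (Imp \<phi> \<psi>)" "derivable_global \<Sigma> (Imp \<psi> \<chi>)"
  shows "derivable_global \<Sigma> (Imp \<phi> \<chi>)"
  using assms by (rule derivable_global_consequence2) (auto simp: tautology_simps)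

lemma derivable_global_Imp_And_iff:
  "derivable_global \<Sigma> (Imp \<phi> (And \<psi> \<chi>)) \<longleftrightarrow>
    derivable_global \<Sigma> (Imp \<phi> \<psi>) \<and> derivable_global \<Sigma> (Imp \<phi> \<chi>)"
proof (intro iffI conjI)
  assume "derivable_global \<Sigma> (Imp \<phi> \<psi>) \<and> derivable_global \<Sigma> (Imp \<phi> \<chi>)"
  then show "derivable_global \<Sigma> (Imp \<phi> (And \<psi> \<chi>))"
    using derivable_global_consequence2[of \<Sigma> "Imp \<phi> \<psi>" "Imp \<phi> \<chi>"]
    by (auto simp: tautology_simps)
qed (erule derivable_global_consequence, simp add: tautology_simps)+

lemma CK_imp_EK: "derivable_global \<Sigma> (Imp (CK \<phi>) (EK \<phi>))"
  and CK_imp_EK_CK: "derivable_global \<Sigma> (Imp (CK \<phi>) (EK (CK \<phi>)))"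
  using derivable_global_axiom[OF C_unfold] by (auto simp: derivable_global_Imp_And_iff)

lemma EK_imp_Box: "derivable_global \<Sigma> (Imp (EK \<phi>) (Box i \<phi>))"
  by (rule derivable_global_tautology) (auto simp: tautology_simps)

text \<open>
  Necessitation for \<open>\<box>\<^sub>i\<close> is not a rule of the calculus; it comes from necessitation for \<open>C\<close>.
\<close>

lemma derivable_global_Box:
  assumes "derivable_global \<Sigma> \<phi>"
  shows "derivable_global \<Sigma> (Box i \<phi>)"
  using derivable_global_nec[OF assms] CK_imp_EK EK_imp_Box derivable_global_mp by blast

text \<open>
  The laws \<open>T\<close> and \<open>4\<close> for \<open>C\<close> are not axioms. The first follows through \<open>E\<close> from \<open>T\<close> for any one
  index, and the index set is non-empty. The second is the rule \<open>\<omega>\<close> for a constant sequence.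
\<close>

lemma CK_imp: "derivable_global \<Sigma> (Imp (CK \<phi>) \<phi>)"
  by (rule derivable_global_Imp_trans[OF CK_imp_EK
        derivable_global_Imp_trans[OF EK_imp_Box derivable_global_axiom[OF box_T]]])

lemma CK_imp_CK_CK: "derivable_global \<Sigma> (Imp (CK \<phi>) (CK (CK \<phi>)))"
  using derivable_global_omega[of \<Sigma> "\<lambda>_. CK \<phi>" "CK \<phi>"]
  by (simp add: derivable_global_Imp_And_iff CK_imp_EK_CK)

lemma derivable_global_Imp_Conj_list:
  "derivable_global \<Sigma> (Imp \<phi> (Conj_list \<psi>s)) \<longleftrightarrow>
    (\<forall>\<psi> \<in> set \<psi>s. derivable_global \<Sigma> (Imp \<phi> \<psi>))"
  by (induction \<psi>s rule: Conj_list.induct)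
    (auto simp: derivable_global_Imp_And_iff tautology_simps intro!: derivable_global_tautology)

lemma derivable_global_Imp_EK:
  "derivable_global \<Sigma> (Imp \<phi> (EK \<psi>)) \<longleftrightarrow> (\<forall>i. derivable_global \<Sigma> (Imp \<phi> (Box i \<psi>)))"
proof -
  obtain \<psi>s where "set \<psi>s = range (\<lambda>i. Box i \<psi>)" "EK \<psi> = Conj_list \<psi>s"
    unfolding EK_def by (rule Conj_enumeration[of "range (\<lambda>i. Box i \<psi>)"]) auto
  then show ?thesis
    by (simp add: derivable_global_Imp_Conj_list)
qed

lemma derivable_assumption: "\<phi> \<in> \<Gamma> \<Longrightarrow> derivable \<Sigma> \<Gamma> \<phi>"
  unfolding derivable_def
  by (rule exI[of _ "{\<phi>}"]) (auto intro!: derivable_global_tautology simp: tautology_simps)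

lemma derivable_Top: "derivable \<Sigma> \<Gamma> Top"
  unfolding derivable_def
  by (rule exI[of _ "{}"]) (auto intro!: derivable_global_tautology simp: tautology_simps)

lemma derivable_weaken:
  "derivable \<Sigma> \<Gamma> \<phi> \<Longrightarrow> derivable_global \<Sigma> (Imp \<phi> \<psi>) \<Longrightarrow> derivable \<Sigma> \<Gamma> \<psi>"
  unfolding derivable_def by (meson derivable_global_Imp_trans)

lemma derivable_And:
  assumes "derivable \<Sigma> \<Gamma> \<phi>" "derivable \<Sigma> \<Gamma> \<psi>"
  shows "derivable \<Sigma> \<Gamma> (And \<phi> \<psi>)"
proof -
  from assms obtain \<Phi> \<Psi> where fin: "finite \<Phi>" "\<Phi> \<subseteq> \<Gamma>" "finite \<Psi>" "\<Psi> \<subseteq> \<Gamma>"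
    and der: "derivable_global \<Sigma> (Imp (Conj \<Phi>) \<phi>)" "derivable_global \<Sigma> (Imp (Conj \<Psi>) \<psi>)"
    by (auto simp: derivable_def)
  from der have "derivable_global \<Sigma> (Imp (Conj (\<Phi> \<union> \<Psi>)) (And \<phi> \<psi>))"
    by (rule derivable_global_consequence2) (use fin in \<open>auto simp: tautology_simps\<close>)
  then show ?thesis
    unfolding derivable_def using fin by (intro exI[of _ "\<Phi> \<union> \<Psi>"]) auto
qed


section \<open>The Lindenbaum algebra\<close>

instance fm :: (countable) countable
  by countable_datatype

text \<open>
  This realises a quotient of the formulas inside the universe type: \<open>q\<close> picks a representative of the
  class and encodes it as an element of \<open>'u\<close>.
\<close>

lemma equivalence_classes_into_infinite_type:
  fixes R :: "'a::countable \<Rightarrow> 'a \<Rightarrow> bool"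
  assumes "equivp R" "infinite (UNIV :: 'u set)"
  obtains q :: "'a \<Rightarrow> 'u" where "\<And>x y. q x = q y \<longleftrightarrow> R x y"
proof -
  obtain f :: "nat \<Rightarrow> 'u" where f: "inj f"
    using infinite_countable_subset[OF assms(2)] by blast
  have eps: "R x (Eps (R x))" for x
    using equivp_reflp[OF assms(1)] by (rule someI)
  have "f (to_nat (Eps (R x))) = f (to_nat (Eps (R y))) \<longleftrightarrow> R x y" for x y
    using eps[of x] eps[of y] assms(1) f unfolding equivp_def by (metis from_nat_to_nat injD)
  then show thesis by (rule that)
qed

text \<open>
  The map \<open>q\<close> plays the part of the quotient map: its kernel is equivalence provable from \<open>\<Sigma>\<close>, and
  its range, rather than a set of classes, is the carrier of the algebra.
\<close>

locale lindenbaum =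
  fixes \<Sigma> :: "'i::finite fm set" and q :: "'i fm \<Rightarrow> 'u"
  assumes q_eq_iff:
    "q \<phi> = q \<psi> \<longleftrightarrow> derivable_global \<Sigma> (Imp \<phi> \<psi>) \<and> derivable_global \<Sigma> (Imp \<psi> \<phi>)"
begin

abbreviation provable :: "'i fm \<Rightarrow> bool"
  where "provable \<equiv> derivable_global \<Sigma>"

text \<open>
  The operations act on the representative \<open>inv q x\<close>; by monotonicity of the modalities the choice
  does not affect the result.
\<close>

definition alg :: "('u, 'i) modal_lattice"
  where "alg = \<lparr>carrier = range q, eq = (=),
    le = (\<lambda>x y. provable (Imp (inv q x) (inv q y))),
    box = (\<lambda>i x. q (Box i (inv q x))), ck = (\<lambda>x. q (CK (inv q x)))\<rparr>"

lemma carrier_alg [simp]: "carrier alg = range q"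
  by (simp add: alg_def)

lemma provable_representative:
  "provable (Imp (inv q (q \<phi>)) \<phi>)" "provable (Imp \<phi> (inv q (q \<phi>)))"
  using q_eq_iff[of "inv q (q \<phi>)" \<phi>] by (simp_all add: f_inv_into_f)

lemma le_alg [simp]: "q \<phi> \<sqsubseteq>\<^bsub>alg\<^esub> q \<psi> \<longleftrightarrow> provable (Imp \<phi> \<psi>)"
  unfolding alg_def
  by simp (meson derivable_global_Imp_trans provable_representative)

lemma q_eqI: "tautology (Imp \<phi> \<psi>) \<Longrightarrow> tautology (Imp \<psi> \<phi>) \<Longrightarrow> q \<phi> = q \<psi>"
  by (simp add: q_eq_iff derivable_global_tautology)

lemma partial_order_alg: "partial_order alg"
proof
  show eq: "(.=\<^bsub>alg\<^esub>) = (=)"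
    by (simp add: alg_def)
  show "x \<sqsubseteq>\<^bsub>alg\<^esub> x" if "x \<in> carrier alg" for x
    using that by (auto intro!: derivable_global_tautology simp: tautology_simps)
  show "x .=\<^bsub>alg\<^esub> y" if "x \<sqsubseteq>\<^bsub>alg\<^esub> y" "y \<sqsubseteq>\<^bsub>alg\<^esub> x" "x \<in> carrier alg" "y \<in> carrier alg" for x y
    using that by (auto simp: eq q_eq_iff)
  show "x \<sqsubseteq>\<^bsub>alg\<^esub> z"
    if "x \<sqsubseteq>\<^bsub>alg\<^esub> y" "y \<sqsubseteq>\<^bsub>alg\<^esub> z" "x \<in> carrier alg" "y \<in> carrier alg" "z \<in> carrier alg" for x y z
    using that by (auto dest: derivable_global_Imp_trans)
qed (simp_all add: alg_def)

interpretation alg: partial_order alg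
  by (rule partial_order_alg)

lemma is_glb_alg:
  assumes "\<And>\<phi>. \<phi> \<in> \<Phi> \<Longrightarrow> provable (Imp \<chi> \<phi>)"
    and "\<And>\<zeta>. (\<And>\<phi>. \<phi> \<in> \<Phi> \<Longrightarrow> provable (Imp \<zeta> \<phi>)) \<Longrightarrow> provable (Imp \<zeta> \<chi>)"
  shows "is_glb alg (q \<chi>) (q ` \<Phi>)"
proof (rule greatest_LowerI)
  fix y
  assume "y \<in> Lower alg (q ` \<Phi>)"
  then obtain \<zeta> where "y = q \<zeta>" "\<And>\<phi>. \<phi> \<in> \<Phi> \<Longrightarrow> q \<zeta> \<sqsubseteq>\<^bsub>alg\<^esub> q \<phi>"
    by (auto simp: Lower_def simp del: le_alg)
  then show "y \<sqsubseteq>\<^bsub>alg\<^esub> q \<chi>"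
    by (simp add: assms(2))
qed (auto simp: assms(1))

lemma is_lub_alg:
  assumes "\<And>\<phi>. \<phi> \<in> \<Phi> \<Longrightarrow> provable (Imp \<phi> \<chi>)"
    and "\<And>\<zeta>. (\<And>\<phi>. \<phi> \<in> \<Phi> \<Longrightarrow> provable (Imp \<phi> \<zeta>)) \<Longrightarrow> provable (Imp \<chi> \<zeta>)"
  shows "is_lub alg (q \<chi>) (q ` \<Phi>)"
proof (rule least_UpperI)
  fix y
  assume "y \<in> Upper alg (q ` \<Phi>)"
  then obtain \<zeta> where "y = q \<zeta>" "\<And>\<phi>. \<phi> \<in> \<Phi> \<Longrightarrow> q \<phi> \<sqsubseteq>\<^bsub>alg\<^esub> q \<zeta>"
    by (auto simp: Upper_def simp del: le_alg)
  then show "q \<chi> \<sqsubseteq>\<^bsub>alg\<^esub> y"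
    by (simp add: assms(2))
qed (auto simp: assms(1))

lemma inf_alg: "is_glb alg x A \<Longrightarrow> \<Sqinter>\<^bsub>alg\<^esub> A = x"
  unfolding inf_def by (metis alg.greatest_unique someI)

lemma sup_alg: "is_lub alg x A \<Longrightarrow> \<Squnion>\<^bsub>alg\<^esub> A = x"
  unfolding sup_def by (metis alg.least_unique someI)

lemma is_glb_And: "is_glb alg (q (And \<phi> \<psi>)) {q \<phi>, q \<psi>}"
proof -
  have "is_glb alg (q (And \<phi> \<psi>)) (q ` {\<phi>, \<psi>})"
    by (rule is_glb_alg)
      (auto simp: derivable_global_Imp_And_iff tautology_simps intro!: derivable_global_tautology)
  then show ?thesis by simp
qed

lemma is_lub_Or: "is_lub alg (q (Imp (Neg \<phi>) \<psi>)) {q \<phi>, q \<psi>}"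
proof -
  have "is_lub alg (q (Imp (Neg \<phi>) \<psi>)) (q ` {\<phi>, \<psi>})"
  proof (rule is_lub_alg)
    fix \<zeta>
    assume "\<And>\<xi>. \<xi> \<in> {\<phi>, \<psi>} \<Longrightarrow> provable (Imp \<xi> \<zeta>)"
    then have "provable (Imp \<phi> \<zeta>)" "provable (Imp \<psi> \<zeta>)" by auto
    then show "provable (Imp (Imp (Neg \<phi>) \<psi>) \<zeta>)"
      by (rule derivable_global_consequence2) (auto simp: tautology_simps)
  qed (auto simp: tautology_simps intro!: derivable_global_tautology)
  then show ?thesis by simp
qed

lemma meet_alg [simp]: "q \<phi> \<sqinter>\<^bsub>alg\<^esub> q \<psi> = q (And \<phi> \<psi>)"
  unfolding meet_def by (rule inf_alg is_glb_And)+

lemma join_alg [simp]: "q \<phi> \<squnion>\<^bsub>alg\<^esub> q \<psi> = q (Imp (Neg \<phi>) \<psi>)"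
  unfolding join_def by (rule sup_alg is_lub_Or)+

lemma greatest_Top: "greatest alg (q Top) (carrier alg)"
  by (auto simp: greatest_def tautology_simps intro!: derivable_global_tautology)

lemma least_Bot: "least alg (q Bot) (carrier alg)"
  by (auto simp: least_def tautology_simps intro!: derivable_global_tautology)

lemma top_alg [simp]: "\<top>\<^bsub>alg\<^esub> = q Top"
  unfolding top_def by (metis alg.greatest_unique someI greatest_Top)

lemma bottom_alg [simp]: "\<bottom>\<^bsub>alg\<^esub> = q Bot"
  unfolding bottom_def by (metis alg.least_unique someI least_Bot)

lemma boolean_lattice_alg: "boolean_lattice alg"
proof
  show "\<exists>s. is_lub alg s {x, y}" if "x \<in> carrier alg" "y \<in> carrier alg" for x y
    using that is_lub_Or by auto
  show "\<exists>s. is_glb alg s {x, y}" if "x \<in> carrier alg" "y \<in> carrier alg" for x y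
    using that is_glb_And by auto
  show "\<exists>x. least alg x (carrier alg)" "\<exists>x. greatest alg x (carrier alg)"
    using least_Bot greatest_Top by blast+
  show "x \<sqinter>\<^bsub>alg\<^esub> (y \<squnion>\<^bsub>alg\<^esub> z) = x \<sqinter>\<^bsub>alg\<^esub> y \<squnion>\<^bsub>alg\<^esub> (x \<sqinter>\<^bsub>alg\<^esub> z)"
    if "x \<in> carrier alg" "y \<in> carrier alg" "z \<in> carrier alg" for x y z
    using that by (auto intro!: q_eqI simp: tautology_simps)
  show "\<exists>y \<in> carrier alg. x \<sqinter>\<^bsub>alg\<^esub> y = \<bottom>\<^bsub>alg\<^esub> \<and> x \<squnion>\<^bsub>alg\<^esub> y = \<top>\<^bsub>alg\<^esub>"
    if "x \<in> carrier alg" for x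
  proof -
    from that obtain \<phi> where "x = q \<phi>" by auto
    then show ?thesis
      by (intro bexI[of _ "q (Neg \<phi>)"]) (auto intro!: q_eqI simp: tautology_simps)
  qed
qed

interpretation alg: boolean_lattice alg
  by (rule boolean_lattice_alg)

lemma implication_alg [simp]: "implication alg (q \<phi>) (q \<psi>) = q (Imp \<phi> \<psi>)"
proof -
  have "complement alg (q \<phi>) = q (Neg \<phi>)"
    by (rule alg.complement_eqI) (auto intro!: q_eqI simp: tautology_simps)
  then show ?thesis
    by (auto simp: implication_def intro!: q_eqI simp: tautology_simps)
qed

lemma modal_monotone:
  assumes nec: "\<And>\<phi>. provable \<phi> \<Longrightarrow> provable (M \<phi>)"
    and K: "\<And>\<phi> \<psi>. provable (Imp (M (Imp \<phi> \<psi>)) (Imp (M \<phi>) (M \<psi>)))"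
    and "provable (Imp \<phi> \<psi>)"
  shows "provable (Imp (M \<phi>) (M \<psi>))"
  using assms derivable_global_mp by blast

lemma Box_monotone: "provable (Imp \<phi> \<psi>) \<Longrightarrow> provable (Imp (Box i \<phi>) (Box i \<psi>))"
  by (rule modal_monotone) (auto intro: derivable_global_Box derivable_global_axiom box_K)

lemma CK_monotone: "provable (Imp \<phi> \<psi>) \<Longrightarrow> provable (Imp (CK \<phi>) (CK \<psi>))"
  by (rule modal_monotone) (auto intro: derivable_global_nec derivable_global_axiom C_K)

lemma box_alg [simp]: "box alg i (q \<phi>) = q (Box i \<phi>)"
  using Box_monotone provable_representative by (simp add: alg_def q_eq_iff)

lemma ck_alg [simp]: "ck alg (q \<phi>) = q (CK \<phi>)"
  using CK_monotone provable_representative by (simp add: alg_def q_eq_iff)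

lemma ek_alg [simp]: "ek alg (q \<phi>) = q (EK \<phi>)"
proof -
  have "is_glb alg (q (EK \<phi>)) (q ` range (\<lambda>i. Box i \<phi>))"
    by (rule is_glb_alg) (auto simp: EK_imp_Box derivable_global_Imp_EK)
  then show ?thesis
    unfolding ek_def by (intro inf_alg) (simp add: image_image)
qed

text \<open>
  Common to the boxes and \<open>C\<close>: a normal modality with \<open>T\<close> and \<open>4\<close> induces an interior operator.
\<close>

lemma interior_algebra_alg:
  assumes f: "\<And>\<phi>. f (q \<phi>) = q (M \<phi>)"
    and nec: "\<And>\<phi>. provable \<phi> \<Longrightarrow> provable (M \<phi>)"
    and K: "\<And>\<phi> \<psi>. provable (Imp (M (Imp \<phi> \<psi>)) (Imp (M \<phi>) (M \<psi>)))"
    and T: "\<And>\<phi>. provable (Imp (M \<phi>) \<phi>)"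
    and four: "\<And>\<phi>. provable (Imp (M \<phi>) (M (M \<phi>)))"
  shows "interior_algebra alg f"
proof
  have mono: "provable (Imp (M \<phi>) (M \<psi>))" if "provable (Imp \<phi> \<psi>)" for \<phi> \<psi>
    using nec K that by (rule modal_monotone)
  show "f x \<in> carrier alg" if "x \<in> carrier alg" for x
    using that f by auto
  have "provable (M Top)"
    by (intro nec derivable_global_tautology) (simp add: tautology_simps)
  then have "provable (Imp Top (M Top))"
    by (rule derivable_global_consequence) (simp add: tautology_simps)
  then show "f \<top>\<^bsub>alg\<^esub> = \<top>\<^bsub>alg\<^esub>"
    using T by (simp add: f q_eq_iff)
  show "f (x \<sqinter>\<^bsub>alg\<^esub> y) = f x \<sqinter>\<^bsub>alg\<^esub> f y" if "x \<in> carrier alg" "y \<in> carrier alg" for x y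
  proof -
    from that obtain \<phi> \<psi> where xy: "x = q \<phi>" "y = q \<psi>"
      by auto
    have "provable (Imp \<phi> (Imp \<psi> (And \<phi> \<psi>)))"
      by (rule derivable_global_tautology) (simp add: tautology_simps)
    then have "provable (Imp (M \<phi>) (M (Imp \<psi> (And \<phi> \<psi>))))"
      by (rule mono)
    then have "provable (Imp (And (M \<phi>) (M \<psi>)) (M (And \<phi> \<psi>)))"
      using K by (rule derivable_global_consequence2) (auto simp: tautology_simps)
    moreover have "provable (Imp (M (And \<phi> \<psi>)) (M \<phi>))" "provable (Imp (M (And \<phi> \<psi>)) (M \<psi>))"
      by (rule mono, rule derivable_global_tautology, simp add: tautology_simps)+
    ultimately show ?thesis
      by (simp add: xy f q_eq_iff derivable_global_Imp_And_iff)
  qed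
  show "f x = f (f x)" if "x \<in> carrier alg" for x
    using that T four by (auto simp: f q_eq_iff)
  show "f x \<sqsubseteq>\<^bsub>alg\<^esub> x" if "x \<in> carrier alg" for x
    using that T by (auto simp: f)
qed

text \<open>
  The remaining laws are axioms of the calculus read modulo equivalence. Standardness is the rule
  \<open>\<omega>\<close>, applied to formulas that represent the given sequence.
\<close>

lemma standard_s4c_algebra_alg: "standard_s4c_algebra alg"
proof (intro standard_s4c_algebra.intro s4c_algebra.intro s4c_algebra_axioms.intro
    standard_s4c_algebra_axioms.intro boolean_lattice_alg)
  show "interior_algebra alg (box alg i)" for i
    by (rule interior_algebra_alg[where M = "Box i"])
      (auto intro: derivable_global_Box derivable_global_axiom box_K box_T box_4)
  show "interior_algebra alg (ck alg)"
    by (rule interior_algebra_alg[where M = CK])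
      (auto intro: derivable_global_nec derivable_global_axiom C_K CK_imp CK_imp_CK_CK)
  show "ck alg a \<sqsubseteq>\<^bsub>alg\<^esub> ek alg a \<sqinter>\<^bsub>alg\<^esub> ek alg (ck alg a)" if "a \<in> carrier alg" for a
    using that by (auto intro!: derivable_global_axiom[OF C_unfold])
  show "ek alg a \<sqinter>\<^bsub>alg\<^esub> ck alg (implication alg a (ek alg a)) \<sqsubseteq>\<^bsub>alg\<^esub> ck alg a"
    if "a \<in> carrier alg" for a
    using that by (auto intro!: derivable_global_axiom[OF C_ind])
  show "a 0 \<sqsubseteq>\<^bsub>alg\<^esub> ck alg d"
    if "d \<in> carrier alg" and a: "\<And>j. a j \<in> carrier alg"
      and le: "\<And>j. a j \<sqsubseteq>\<^bsub>alg\<^esub> ek alg d \<sqinter>\<^bsub>alg\<^esub> ek alg (a (Suc j))" for d a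
  proof -
    from that(1) obtain \<psi> where d: "d = q \<psi>"
      by auto
    have "\<forall>j. \<exists>\<chi>. a j = q \<chi>"
      using a by auto
    then obtain \<chi> where \<chi>: "\<And>j. a j = q (\<chi> j)"
      by metis
    have "provable (Imp (\<chi> j) (And (EK \<psi>) (EK (\<chi> (Suc j)))))" for j
      using le[of j] by (simp add: \<chi> d)
    then have "provable (Imp (\<chi> 0) (CK \<psi>))"
      by (rule derivable_global_omega)
    then show ?thesis
      by (simp add: \<chi> d)
  qed
qed

lemma valuation_q: "valuation alg q"
  by (simp add: valuation_def)

lemma q_assumption: "\<xi> \<in> \<Sigma> \<Longrightarrow> q \<xi> = \<top>\<^bsub>alg\<^esub>"
  by (auto simp: q_eq_iff tautology_simps intro: derivable_global_tautology
      derivable_global_consequence[OF derivable_global_assumption])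

lemma lattice_filter_derivable: "lattice_filter alg (q ` {\<psi>. derivable \<Sigma> \<Gamma> \<psi>})"
  by (auto simp: lattice_filter_def intro: derivable_Top derivable_And derivable_weaken)

text \<open>
  The classes of the formulas derivable from \<open>\<Gamma>\<close> form a filter containing the classes of \<open>\<Gamma>\<close>, and
  thus the whole generated filter.
\<close>

lemma derivable_if_in_generated_filter:
  assumes "q \<phi> \<in> generated_filter alg (q ` \<Gamma>)"
  shows "derivable \<Sigma> \<Gamma> \<phi>"
proof -
  have "q \<phi> \<in> q ` {\<psi>. derivable \<Sigma> \<Gamma> \<psi>}"
    using assms lattice_filter_derivable derivable_assumption
    unfolding generated_filter_def by blast
  then obtain \<psi> where "q \<phi> = q \<psi>" "derivable \<Sigma> \<Gamma> \<psi>"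
    by auto
  then show ?thesis
    using derivable_weaken q_eq_iff by blast
qed

end

theorem theorem1:
  fixes \<Sigma> \<Gamma> :: "'i::finite fm set" and \<phi> :: "'i fm"
  assumes "infinite (UNIV :: 'u set)"
  shows "derivable \<Sigma> \<Gamma> \<phi> \<longleftrightarrow> alg_consequence TYPE('u) \<Sigma> \<Gamma> \<phi>"
proof
  assume "derivable \<Sigma> \<Gamma> \<phi>"
  then show "alg_consequence TYPE('u) \<Sigma> \<Gamma> \<phi>"
    by (auto simp: alg_consequence_def intro: standard_s4c_algebra.derivable_in_generated_filter)
next
  assume cons: "alg_consequence TYPE('u) \<Sigma> \<Gamma> \<phi>"
  let ?R = "\<lambda>\<phi> \<psi>. derivable_global \<Sigma> (Imp \<phi> \<psi>) \<and> derivable_global \<Sigma> (Imp \<psi> \<phi>)"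
  have "equivp ?R"
  proof (rule equivpI)
    show "reflp ?R"
      by (auto simp: reflp_def tautology_simps intro!: derivable_global_tautology)
    show "symp ?R"
      by (auto simp: symp_def)
    show "transp ?R"
      unfolding transp_def by (meson derivable_global_Imp_trans)
  qed
  then obtain q :: "'i fm \<Rightarrow> 'u" where "\<And>\<phi> \<psi>. q \<phi> = q \<psi> \<longleftrightarrow> ?R \<phi> \<psi>"
    using equivalence_classes_into_infinite_type assms by blast
  then interpret lindenbaum \<Sigma> q
    by unfold_locales
  show "derivable \<Sigma> \<Gamma> \<phi>"
    using cons standard_s4c_algebra_alg valuation_q q_assumption
    by (intro derivable_if_in_generated_filter) (auto simp: alg_consequence_def)
qed

end
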